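(* Let $k\ge 2$, let $G$ be a connected $k$-uniform hypergraph with $|E(G)|\ge 1$, and let $u\in V(G)$. Then for all integers $p\ge q\ge 1$, $$\rho(G_u(p,q))<\rho(G_u(p+1,q-1)).$$
   Context: All hypergraphs are finite. A hypergraph $G$ consists of a nonempty vertex set $V(G)$ and an edge set $E(G)$ whose elements are nonempty subsets of $V(G)$. It is $k$-uniform ($k\ge 2$) if every edge has exactly $k$ vertices. A walk of length $p$ from $u$ to $v$ is a sequence $(v_0,e_1,v_1,\dots,v_{p-1},e_p,v_p)$ with $v_0=u$, $v_p=v$, each $e_i$ an edge containing $v_{i-1}$ and $v_i$, and $v_{i-1}\ne v_i$. A path is a walk with all $v_i$ distinct and all $e_i$ distinct; a single vertex is a path of length $0$. $G$ is connected if there is a path between any two vertices. For connected $G$, the distance $d_G(u,v)$ is the length of a shortest path from $u$ to $v$ (with $d_G(u,u)=0$), the distance matrix is $D(G)=(d_G(u,v))_{u,v\in V(G)}$, and the distance spectral radius $\rho(G)$ is the largest eigenvalue of $D(G)$. Attaching a pendant path of length $p\ge 1$ at a vertex $u$ of a $k$-uniform hypergraph means adding $p(k-1)$ new vertices and $p$ new edges $e_1,\dots,e_p$ of size $k$ forming a path $(u_0,e_1,u_1,\dots,u_{p-1},e_p,u_p)$ with $u_0=u$, such that all vertices of $e_1\cup\dots\cup e_p$ other than $u$ are new, $e_i\cap e_{i+1}=\{u_i\}$ for $1\le i\le p-1$, and every new vertex other than $u_1,\dots,u_{p-1}$ lies in exactly one edge. For $u\in V(G)$ and positive integers $p,q$,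 $G_u(p,q)$ is the $k$-uniform hypergraph obtained from $G$ by attaching two pendant paths, of lengths $p$ and $q$ (with disjoint sets of new vertices), at $u$; and $G_u(p,0)$ is obtained from $G$ by attaching one pendant path of length $p$ at $u$. *)

theory Defs
  imports "Jordan_Normal_Form.Char_Poly"
begin

record 'a hypergraph =
  verts :: "'a set"
  edges :: "'a set set"

definition hypergraph :: "'a hypergraph \<Rightarrow> bool" where
  "hypergraph G \<longleftrightarrow>
     finite (verts G) \<and> verts G \<noteq> {} \<and> (\<forall>e\<in>edges G. e \<noteq> {} \<and> e \<subseteq> verts G)"

definition uniform :: "nat \<Rightarrow> 'a hypergraph \<Rightarrow> bool" where
  "uniform k G \<longleftrightarrow> (\<forall>e\<in>edges G. card e = k)"

text \<open>The walk \<open>(v\<^sub>0, e\<^sub>1, v\<^sub>1, \<dots>, e\<^sub>p, v\<^sub>p)\<close> is stored as the list \<open>vs\<close> of its \<open>p + 1\<close>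
  vertices and the list \<open>es\<close> of its \<open>p\<close> edges, so that \<open>e\<^sub>i\<close> is \<open>es ! (i - 1)\<close>.\<close>

definition is_walk :: "'a hypergraph \<Rightarrow> 'a \<Rightarrow> 'a list \<Rightarrow> 'a set list \<Rightarrow> 'a \<Rightarrow> bool" where
  "is_walk G u vs es v \<longleftrightarrow>
     length vs = length es + 1 \<and> hd vs = u \<and> last vs = v \<and>
     set vs \<subseteq> verts G \<and> set es \<subseteq> edges G \<and>
     (\<forall>i<length es. vs ! i \<in> es ! i \<and> vs ! (i + 1) \<in> es ! i \<and> vs ! i \<noteq> vs ! (i + 1))"

definition is_path :: "'a hypergraph \<Rightarrow> 'a \<Rightarrow> 'a list \<Rightarrow> 'a set list \<Rightarrow> 'a \<Rightarrow> bool" where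
  "is_path G u vs es v \<longleftrightarrow> is_walk G u vs es v \<and> distinct vs \<and> distinct es"

definition connected_hypergraph :: "'a hypergraph \<Rightarrow> bool" where
  "connected_hypergraph G \<longleftrightarrow> (\<forall>u\<in>verts G. \<forall>v\<in>verts G. \<exists>vs es. is_path G u vs es v)"

definition hdist :: "'a hypergraph \<Rightarrow> 'a \<Rightarrow> 'a \<Rightarrow> nat" where
  "hdist G u v = (LEAST n. \<exists>vs es. is_path G u vs es v \<and> length es = n)"

text \<open>The library's matrices are indexed by an initial segment of the natural numbers, so the rows
  and columns of the distance matrix are numbered along an arbitrary enumeration of the vertices.
  By \<open>eigenvalue_distance_matrix_iff\<close> below, its eigenvalues do not depend on the enumeration.
  For a connected hypergraph the matrix is real symmetric, so all its complex eigenvalues are real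
  and the real ones form a finite nonempty set.\<close>

definition vert_list :: "'a hypergraph \<Rightarrow> 'a list" where
  "vert_list G = (SOME vs. distinct vs \<and> set vs = verts G)"

definition distance_matrix :: "'a hypergraph \<Rightarrow> real mat" where
  "distance_matrix G =
     mat (card (verts G)) (card (verts G))
       (\<lambda>(i, j). real (hdist G (vert_list G ! i) (vert_list G ! j)))"

definition distance_spectral_radius :: "'a hypergraph \<Rightarrow> real" where
  "distance_spectral_radius G = Max {\<mu>. eigenvalue (distance_matrix G) \<mu>}"

lemma vert_list:
  assumes "hypergraph G"
  shows "distinct (vert_list G)" "set (vert_list G) = verts G"
    "length (vert_list G) = card (verts G)"
proof -
  let ?P = "\<lambda>vs. distinct vs \<and> set vs = verts G"
  have "finite (verts G)"
    using assms by (simp add: hypergraph_def)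
  then obtain vs where "?P vs"
    using finite_distinct_list[of "verts G"] by auto
  then have *: "?P (vert_list G)"
    unfolding vert_list_def by (rule someI[of ?P])
  then show "distinct (vert_list G)" "set (vert_list G) = verts G"
    "length (vert_list G) = card (verts G)"
    using distinct_card[of "vert_list G"] by simp_all
qed

lemma eigenvalue_distance_matrix_iff:
  assumes "hypergraph G"
  shows "eigenvalue (distance_matrix G) \<mu> \<longleftrightarrow>
    (\<exists>x. (\<exists>v\<in>verts G. x v \<noteq> 0) \<and>
         (\<forall>u\<in>verts G. (\<Sum>v\<in>verts G. real (hdist G u v) * x v) = \<mu> * x u))"
    (is "_ \<longleftrightarrow> (\<exists>x. ?E x)")
proof -
  define n where "n = card (verts G)"
  define vs where "vs = vert_list G"
  have vs: "distinct vs" "set vs = verts G" "length vs = n"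
    using vert_list[OF assms] by (auto simp: vs_def n_def)
  have bij: "bij_betw ((!) vs) {0..<n} (verts G)"
    using bij_betw_nth[OF vs(1), of "{0..<n}" "verts G"] vs by (simp add: atLeast0LessThan)
  have sum_eq: "(\<Sum>v\<in>verts G. f v) = (\<Sum>j\<in>{0..<n}. f (vs ! j))" for f :: "_ \<Rightarrow> real"
    by (rule sum.reindex_bij_betw[OF bij, symmetric])
  have in_iff: "(\<forall>v\<in>verts G. P v) \<longleftrightarrow> (\<forall>i<n. P (vs ! i))"
               "(\<exists>v\<in>verts G. P v) \<longleftrightarrow> (\<exists>i<n. P (vs ! i))" for P
  proof -
    have "verts G = (!) vs ` {0..<n}"
      using bij by (simp add: bij_betw_def)
    then show "(\<forall>v\<in>verts G. P v) \<longleftrightarrow> (\<forall>i<n. P (vs ! i))"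
              "(\<exists>v\<in>verts G. P v) \<longleftrightarrow> (\<exists>i<n. P (vs ! i))"
      by auto
  qed
  have dim: "dim_row (distance_matrix G) = n"
    by (simp add: distance_matrix_def n_def)
  have ev: "eigenvector (distance_matrix G) w \<mu> \<longleftrightarrow>
      dim_vec w = n \<and> (\<exists>i<n. w $ i \<noteq> 0) \<and>
      (\<forall>i<n. (\<Sum>j\<in>{0..<n}. real (hdist G (vs ! i) (vs ! j)) * w $ j) = \<mu> * w $ i)" for w
  proof (cases "dim_vec w = n")
    case True
    have row: "(distance_matrix G *\<^sub>v w) $ i =
        (\<Sum>j\<in>{0..<n}. real (hdist G (vs ! i) (vs ! j)) * w $ j)" if "i < n" for i
      using that True
      by (simp add: distance_matrix_def n_def[symmetric] vs_def[symmetric] scalar_prod_def)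
    have "w \<noteq> 0\<^sub>v n \<longleftrightarrow> (\<exists>i<n. w $ i \<noteq> 0)"
      using True by (simp add: vec_eq_iff)
    moreover have "distance_matrix G *\<^sub>v w = \<mu> \<cdot>\<^sub>v w \<longleftrightarrow>
        (\<forall>i<n. (\<Sum>j\<in>{0..<n}. real (hdist G (vs ! i) (vs ! j)) * w $ j) = \<mu> * w $ i)"
      (is "?A = ?B \<longleftrightarrow> ?C")
    proof -
      have "?A = ?B \<longleftrightarrow> (\<forall>i<n. ?A $ i = ?B $ i)"
      proof
        assume *: "\<forall>i<n. ?A $ i = ?B $ i"
        show "?A = ?B"
        proof (rule eq_vecI)
          show "dim_vec ?A = dim_vec ?B"
            by (simp only: dim_mult_mat_vec index_smult_vec(2) dim True)
        next
          fix i assume "i < dim_vec ?B"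
          then have "i < n" by (simp only: index_smult_vec(2) True)
          with * show "?A $ i = ?B $ i" by blast
        qed
      qed (simp only: simp_thms)
      also have "\<dots> \<longleftrightarrow> ?C"
      proof -
        have "?B $ i = \<mu> * w $ i" if "i < n" for i
          by (rule index_smult_vec(1)) (simp only: True that)
        then show ?thesis by (simp only: row cong: imp_cong)
      qed
      finally show ?thesis .
    qed
    moreover have "w \<in> carrier_vec n"
      using True by (rule carrier_vecI)
    ultimately show ?thesis
      unfolding eigenvector_def dim using True by blast
  next
    case False
    then show ?thesis
      unfolding eigenvector_def dim using carrier_vecD by blast
  qed
  show ?thesis
  proof
    assume "eigenvalue (distance_matrix G) \<mu>"
    then obtain w where "eigenvector (distance_matrix G) w \<mu>"
      unfolding eigenvalue_def by blast
    note w = this[unfolded ev]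
    define x where "x v = w $ (the_inv_into {0..<n} ((!) vs) v)" for v
    have x: "x (vs ! i) = w $ i" if "i < n" for i
      unfolding x_def using that bij by (simp add: bij_betw_def the_inv_into_f_f)
    have "?E x"
      unfolding sum_eq in_iff using w x by auto
    then show "\<exists>x. ?E x" by blast
  next
    assume "\<exists>x. ?E x"
    then obtain x where "?E x" by blast
    then have "eigenvector (distance_matrix G) (vec n (\<lambda>i. x (vs ! i))) \<mu>"
      unfolding sum_eq in_iff ev by auto
    then show "eigenvalue (distance_matrix G) \<mu>"
      unfolding eigenvalue_def by blast
  qed
qed

text \<open>\<open>attached_pendant_path k G u p H\<close>: the hypergraph \<open>H\<close> arises from \<open>G\<close> by attaching a pendant
  path of length \<open>p\<close> at \<open>u\<close>.\<close>

definition attached_pendant_path ::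
    "nat \<Rightarrow> 'a hypergraph \<Rightarrow> 'a \<Rightarrow> nat \<Rightarrow> 'a hypergraph \<Rightarrow> bool" where
  "attached_pendant_path k G u p H \<longleftrightarrow>
     (\<exists>us es. length es = p \<and> is_path H u us es (us ! p) \<and>
        verts H = verts G \<union> \<Union>(set es) \<and> edges H = edges G \<union> set es \<and>
        (\<forall>e\<in>set es. card e = k) \<and>
        (\<Union>(set es) - {u}) \<inter> verts G = {} \<and> card (\<Union>(set es) - {u}) = p * (k - 1) \<and>
        (\<forall>i. i + 1 < p \<longrightarrow> es ! i \<inter> es ! (i + 1) = {us ! (i + 1)}) \<and>
        (\<forall>w\<in>\<Union>(set es) - {us ! i |i. i < p}. \<exists>!e. e \<in> edges H \<and> w \<in> e))"

text \<open>A concrete representative of \<open>G\<^sub>u(p, q)\<close>. The vertices of \<open>G\<close> are tagged with \<open>Base\<close>;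
  \<open>New s i j\<close> with \<open>j < k - 1\<close> are the new vertices of the \<open>i\<close>-th edge (\<open>i \<ge> 1\<close>) of the pendant path
  number \<open>s\<close>, which is \<open>0\<close> for the path of length \<open>p\<close> and \<open>1\<close> for the path of length \<open>q\<close>. The vertex
  joining the \<open>i\<close>-th edge to the next one is \<open>New s i 0\<close>. For \<open>q = 0\<close> there is no second path.
  The lemmas below check the construction against \<open>attached_pendant_path\<close>.\<close>

datatype 'a pendant_vertex = Base 'a | New nat nat nat

definition base_copy :: "'a hypergraph \<Rightarrow> 'a pendant_vertex hypergraph" where
  "base_copy G = \<lparr>verts = Base ` verts G, edges = (`) Base ` edges G\<rparr>"

definition joint :: "'a \<Rightarrow> nat \<Rightarrow> nat \<Rightarrow> 'a pendant_vertex" where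
  "joint u s i = (if i = 0 then Base u else New s i 0)"

definition new_vertices :: "nat \<Rightarrow> nat \<Rightarrow> nat \<Rightarrow> 'a pendant_vertex set" where
  "new_vertices k s i = {New s i j |j. j < k - 1}"

definition pendant_edge :: "nat \<Rightarrow> 'a \<Rightarrow> nat \<Rightarrow> nat \<Rightarrow> 'a pendant_vertex set" where
  "pendant_edge k u s i = insert (joint u s (i - 1)) (new_vertices k s i)"

definition attach_two ::
    "nat \<Rightarrow> 'a hypergraph \<Rightarrow> 'a \<Rightarrow> nat \<Rightarrow> nat \<Rightarrow> 'a pendant_vertex hypergraph" where
  "attach_two k G u p q =
     \<lparr>verts = Base ` verts G \<union> (\<Union>i\<in>{1..p}. new_vertices k 0 i) \<union> (\<Union>i\<in>{1..q}. new_vertices k 1 i),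
      edges = (`) Base ` edges G \<union> pendant_edge k u 0 ` {1..p} \<union> pendant_edge k u 1 ` {1..q}\<rparr>"

lemma joint_in_pendant_edge:
  "k \<ge> 2 \<Longrightarrow> i \<ge> 1 \<Longrightarrow> joint u s i \<in> pendant_edge k u s i"
  by (auto simp: pendant_edge_def joint_def new_vertices_def)

lemma card_new_vertices: "finite (new_vertices k s i)" "card (new_vertices k s i) = k - 1"
proof -
  have *: "new_vertices k s i = New s i ` {..<k - 1}"
    by (auto simp: new_vertices_def)
  show "finite (new_vertices k s i)" by (simp add: *)
  show "card (new_vertices k s i) = k - 1" unfolding *
    by (subst card_image) (auto simp: inj_on_def)
qed

lemma attached_pendant_pathI:
  fixes H H' :: "'a pendant_vertex hypergraph"
  assumes k: "k \<ge> 2" and p: "p \<ge> 1" and u: "Base u \<in> verts H"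
    and wf: "\<forall>e\<in>edges H. e \<subseteq> verts H"
    and fresh: "\<And>i j. New s i j \<notin> verts H"
    and V: "verts H' = verts H \<union> (\<Union>i\<in>{1..p}. new_vertices k s i)"
    and E: "edges H' = edges H \<union> pendant_edge k u s ` {1..p}"
  shows "attached_pendant_path k H (Base u) p H'"
proof -
  define us where "us = map (joint u s) [0..<p + 1]"
  define es where "es = map (pendant_edge k u s) [1..<p + 1]"
  have nth: "us ! i = joint u s i" if "i \<le> p" for i
    using that by (simp add: us_def nth_append del: upt_Suc)
  have enth: "es ! i = pendant_edge k u s (i + 1)" if "i < p" for i
    using that by (simp add: es_def del: upt_Suc)
  have set_es: "set es = pendant_edge k u s ` {1..p}"
    by (simp add: es_def atLeastLessThanSuc_atLeastAtMost del: upt_Suc)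
  have new_notin: "New s i j \<in> pendant_edge k u s l \<longleftrightarrow>
      (i = l \<and> j < k - 1) \<or> (i = l - 1 \<and> i \<noteq> 0 \<and> j = 0)" for i j l
    by (auto simp: pendant_edge_def joint_def new_vertices_def)
  have Un: "\<Union>(set es) = insert (Base u) (\<Union>i\<in>{1..p}. new_vertices k s i)" (is "_ = insert _ ?N")
  proof
    show "\<Union>(set es) \<subseteq> insert (Base u) ?N"
    proof
      fix w assume "w \<in> \<Union>(set es)"
      then obtain i where i: "i \<in> {1..p}" "w \<in> pendant_edge k u s i" by (auto simp: set_es)
      have "i = 1 \<or> i - 1 \<in> {1..p}" using i(1) by auto
      with i(2) consider "w = Base u" | "w \<in> new_vertices k s i" |
        "i - 1 \<in> {1..p}" "w \<in> new_vertices k s (i - 1)"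
        using k unfolding pendant_edge_def joint_def
        by (auto simp: new_vertices_def split: if_splits)
      then show "w \<in> insert (Base u) ?N" using i(1) by cases blast+
    qed
    have "Base u \<in> pendant_edge k u s 1" by (simp add: pendant_edge_def joint_def)
    then show "insert (Base u) ?N \<subseteq> \<Union>(set es)"
      using p unfolding set_es by (auto simp: pendant_edge_def intro!: bexI[of _ 1])
  qed
  have diff: "\<Union>(set es) - {Base u} = ?N"
    unfolding Un by (auto simp: new_vertices_def)
  have cardN: "card ?N = p * (k - 1)"
    by (subst card_UN_disjoint) (auto simp: card_new_vertices, auto simp: new_vertices_def)
  have inj: "inj_on (pendant_edge k u s) {1..p}"
  proof (rule inj_onI)
    fix i l assume il: "i \<in> {1..p}" "l \<in> {1..p}" and eq: "pendant_edge k u s i = pendant_edge k u s l"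
    have "New s i 0 \<in> pendant_edge k u s l" "New s l 0 \<in> pendant_edge k u s i"
      using eq k new_notin[of i 0 i] new_notin[of l 0 l] by auto
    then show "i = l" using il unfolding new_notin by auto
  qed
  have path: "is_path H' (Base u) us es (us ! p)"
  proof -
    have "set us \<subseteq> verts H'"
      using u k by (auto simp: us_def V joint_def new_vertices_def)
    moreover have "distinct us"
      by (auto simp: us_def distinct_map inj_on_def joint_def simp del: upt_Suc)
    moreover have "distinct es"
      using inj by (simp add: es_def distinct_map atLeastLessThanSuc_atLeastAtMost del: upt_Suc)
    moreover have "hd us = Base u"
      by (simp add: us_def hd_map joint_def del: upt_Suc)
    moreover have "last us = us ! p"
      by (simp add: us_def last_conv_nth del: upt_Suc)
    moreover have "joint u s i \<noteq> joint u s (Suc i)" for i by (simp add: joint_def)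
    moreover have "joint u s i \<in> pendant_edge k u s (Suc i)" for i by (simp add: pendant_edge_def)
    moreover have "joint u s (Suc i) \<in> pendant_edge k u s (Suc i)" for i
      using joint_in_pendant_edge[OF k, of "Suc i" u s] by simp
    moreover have "length us = p + 1" "length es = p"
      by (simp_all add: us_def es_def del: upt_Suc)
    ultimately show ?thesis
      unfolding is_path_def is_walk_def by (auto simp: nth enth E set_es)
  qed
  have cards: "\<forall>e\<in>set es. card e = k"
  proof
    fix e assume "e \<in> set es"
    then obtain i where i: "i \<ge> 1" "e = pendant_edge k u s i" by (auto simp: set_es)
    have "joint u s (i - 1) \<notin> new_vertices k s i"
      using i by (auto simp: joint_def new_vertices_def)
    then show "card e = k"
      using k by (simp add: i pendant_edge_def card_new_vertices)
  qed
  have inter: "es ! i \<inter> es ! (i + 1) = {us ! (i + 1)}" if "i + 1 < p" for i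
    using that k
    by (auto simp: nth enth pendant_edge_def joint_def new_vertices_def split: if_splits)
  have uniq: "\<exists>!e. e \<in> edges H' \<and> w \<in> e" if w: "w \<in> \<Union>(set es) - {us ! i |i. i < p}" for w
  proof -
    have "us ! 0 = Base u" by (simp add: nth joint_def)
    moreover have "us ! 0 \<in> {us ! i |i. i < p}" using p by auto
    ultimately have "w \<noteq> Base u" using w by auto
    then obtain i j where ij: "w = New s i j" "1 \<le> i" "i \<le> p" "j < k - 1"
      using w unfolding Un by (auto simp: new_vertices_def)
    have last: "i = p" if "j = 0"
    proof (rule ccontr)
      assume "i \<noteq> p"
      then have "us ! i = w" "i < p" using ij that by (auto simp: nth joint_def)
      then show False using w by blast
    qed
    show ?thesis
    proof (rule ex1I[of _ "pendant_edge k u s i"])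
      show "pendant_edge k u s i \<in> edges H' \<and> w \<in> pendant_edge k u s i"
        using ij by (auto simp: E new_notin)
    next
      fix e assume e: "e \<in> edges H' \<and> w \<in> e"
      have "e \<notin> edges H" using e wf fresh ij(1) by blast
      then obtain l where l: "l \<in> {1..p}" "e = pendant_edge k u s l" using e by (auto simp: E)
      then show "e = pendant_edge k u s i"
        using e last ij by (auto simp: new_notin)
    qed
  qed
  show ?thesis
    unfolding attached_pendant_path_def
  proof (intro exI[of _ us] exI[of _ es] conjI)
    show "(\<Union>(set es) - {Base u}) \<inter> verts H = {}"
      unfolding diff using fresh by (auto simp: new_vertices_def)
    show "verts H' = verts H \<union> \<Union>(set es)" using V u Un by auto
    show "card (\<Union>(set es) - {Base u}) = p * (k - 1)" using diff cardN by simp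
    show "length es = p" by (simp add: es_def del: upt_Suc)
    show "edges H' = edges H \<union> set es" using E set_es by simp
  qed (use path cards inter uniq in blast)+
qed

lemma attach_two_first:
  assumes "k \<ge> 2" "hypergraph G" "u \<in> verts G" "p \<ge> 1"
  shows "attached_pendant_path k (base_copy G) (Base u) p (attach_two k G u p 0)"
  using assms
  by (intro attached_pendant_pathI[where s = 0])
     (auto simp: base_copy_def attach_two_def hypergraph_def)

lemma attach_two_second:
  assumes "k \<ge> 2" "hypergraph G" "u \<in> verts G" "p \<ge> 1" "q \<ge> 1"
  shows "attached_pendant_path k (attach_two k G u p 0) (Base u) q (attach_two k G u p q)"
proof (rule attached_pendant_pathI[where s = 1])
  have "pendant_edge k u 0 i \<subseteq> verts (attach_two k G u p 0)" if "i \<in> {1..p}" for i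
  proof -
    have "joint u 0 (i - 1) \<in> verts (attach_two k G u p 0)"
      using assms that by (cases "i = 1") (auto simp: joint_def attach_two_def new_vertices_def)
    then show ?thesis using that by (auto simp: pendant_edge_def attach_two_def)
  qed
  moreover have "Base ` e \<subseteq> verts (attach_two k G u p 0)" if "e \<in> edges G" for e
    using assms that by (auto simp: attach_two_def hypergraph_def)
  moreover have "edges (attach_two k G u p 0) =
      (`) Base ` edges G \<union> pendant_edge k u 0 ` {1..p}" by (simp add: attach_two_def)
  ultimately show "\<forall>e\<in>edges (attach_two k G u p 0). e \<subseteq> verts (attach_two k G u p 0)"
    by (simp add: ball_Un)
qed (use assms in \<open>auto simp: attach_two_def new_vertices_def\<close>)

end

theory Submission
  imports Defs "HOL-Analysis.Function_Topology"
begin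

text \<open>The two pendant paths form one loose path with \<open>p + q\<close> edges, on which \<open>G\<close> sits at a joint;
  passing from \<open>G\<^sub>u(p, q)\<close> to \<open>G\<^sub>u(p + 1, q - 1)\<close> moves \<open>G\<close> by one joint. This only affects distances
  between \<open>G - u\<close> and the path: they grow by one towards the side left behind and shrink by at most
  one towards the other side. Hence, if the Perron vector of \<open>G\<^sub>u(p, q)\<close> has at least as much weight
  on the pendant path of length \<open>p\<close> as on the one of length \<open>q\<close>, its Rayleigh quotient increases
  and \<open>\<rho>(G\<^sub>u(p, q)) < \<rho>(G\<^sub>u(p + 1, q - 1))\<close>; in the opposite case, symmetrically,
  \<open>\<rho>(G\<^sub>u(p, q)) < \<rho>(G\<^sub>u(p - 1, q + 1))\<close>. The second alternative is turned into the first one by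
  induction on \<open>p - q\<close>: for \<open>p \<le> q + 1\<close> by symmetry, and for \<open>p \<ge> q + 2\<close> because it contradicts
  the induction hypothesis for \<open>(p - 1, q + 1)\<close>.\<close>

section \<open>Perron vectors and Rayleigh quotients\<close>

definition quad_form :: "('a \<Rightarrow> 'a \<Rightarrow> real) \<Rightarrow> 'a set \<Rightarrow> ('a \<Rightarrow> real) \<Rightarrow> real" where
  "quad_form d V x = (\<Sum>a\<in>V. \<Sum>b\<in>V. d a b * x a * x b)"

lemma quad_form_eigenvector:
  assumes "\<And>a. a \<in> V \<Longrightarrow> (\<Sum>b\<in>V. d a b * x b) = M * x a"
  shows "quad_form d V x = M * (\<Sum>v\<in>V. (x v)\<^sup>2)"
proof -
  have "quad_form d V x = (\<Sum>a\<in>V. x a * (\<Sum>b\<in>V. d a b * x b))"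
    unfolding quad_form_def by (simp add: sum_distrib_left mult_ac)
  also have "\<dots> = M * (\<Sum>v\<in>V. (x v)\<^sup>2)"
    using assms by (simp add: sum_distrib_left power2_eq_square mult_ac)
  finally show ?thesis .
qed

text \<open>Extension by zero outside \<open>V\<close> turns the unit sphere over \<open>V\<close>
  into a closed subset of a product of compact sets, so that Tychonoff's theorem applies in the full
  function space.\<close>

lemma compact_finite_support_sphere:
  assumes "finite V"
  shows "compact {x :: 'a \<Rightarrow> real. (\<forall>v. v \<notin> V \<longrightarrow> x v = 0) \<and> (\<Sum>v\<in>V. (x v)\<^sup>2) = 1}" (is "compact ?S")
proof -
  let ?K = "Pi\<^sub>E UNIV (\<lambda>v. if v \<in> V then {-1..1::real} else {0})"
  have "compactin (product_topology (\<lambda>_. euclidean) UNIV) ?K"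
    unfolding compactin_PiE by auto
  then have "compact ?K"
    by (simp add: euclidean_product_topology)
  moreover have "closed ?S"
    by (intro closed_Collect_conj closed_Collect_all closed_Collect_imp closed_Collect_eq open_Collect_const
        continuous_intros continuous_on_product_coordinates)
  moreover have "?S \<subseteq> ?K"
  proof
    fix x assume x: "x \<in> ?S"
    have "\<bar>x v\<bar> \<le> 1" if "v \<in> V" for v
    proof -
      have "(x v)\<^sup>2 \<le> (\<Sum>v\<in>V. (x v)\<^sup>2)"
        using assms that by (intro member_le_sum) auto
      then show ?thesis using x by (simp add: abs_square_le_1)
    qed
    then show "x \<in> ?K" using x by (auto simp: abs_le_iff)
  qed
  ultimately show ?thesis
    using compact_Int_closed[of ?K ?S] by (simp add: Int_absorb1)
qed

text \<open>The Rayleigh quotient is invariant under scaling, so its maximum over the compact unit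
  sphere bounds it everywhere.\<close>

lemma quad_form_maximizer:
  assumes "finite V" "V \<noteq> {}"
  obtains x where "(\<Sum>v\<in>V. (x v)\<^sup>2) = 1"
    and "\<And>y. quad_form d V y \<le> quad_form d V x * (\<Sum>v\<in>V. (y v)\<^sup>2)"
proof -
  define S where "S = {x :: 'a \<Rightarrow> real. (\<forall>v. v \<notin> V \<longrightarrow> x v = 0) \<and> (\<Sum>v\<in>V. (x v)\<^sup>2) = 1}"
  obtain c where c: "c \<in> V" using assms by blast
  have "(\<Sum>v\<in>V. ((if v = c then 1 else 0) :: real)\<^sup>2) = 1"
    using c assms by (simp add: if_distrib[of "\<lambda>t. t\<^sup>2"] cong: if_cong)
  then have "(\<lambda>v. if v = c then 1 else 0) \<in> S" using c by (auto simp: S_def)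
  then have "S \<noteq> {}" by blast
  moreover have "compact S"
    unfolding S_def by (rule compact_finite_support_sphere) fact
  moreover have "continuous_on S (quad_form d V)"
    unfolding quad_form_def
    by (rule continuous_on_subset[OF _ subset_UNIV])
       (intro continuous_intros continuous_on_product_coordinates)
  ultimately obtain x where x: "x \<in> S" and max: "\<And>y. y \<in> S \<Longrightarrow> quad_form d V y \<le> quad_form d V x"
    using continuous_attains_sup[of S "quad_form d V"] by blast
  show ?thesis
  proof (rule that)
    show "(\<Sum>v\<in>V. (x v)\<^sup>2) = 1" using x by (simp add: S_def)
    fix y :: "'a \<Rightarrow> real"
    define n where "n = (\<Sum>v\<in>V. (y v)\<^sup>2)"
    show "quad_form d V y \<le> quad_form d V x * n"
    proof (cases "n = 0")
      case True
      then have "\<forall>v\<in>V. y v = 0"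
        using assms by (simp add: n_def sum_nonneg_eq_0_iff)
      then show ?thesis using True by (simp add: quad_form_def)
    next
      case False
      then have n: "n > 0" unfolding n_def by (simp add: less_le sum_nonneg)
      define z where "z v = (if v \<in> V then y v / sqrt n else 0)" for v
      have "(\<Sum>v\<in>V. (z v)\<^sup>2) = (\<Sum>v\<in>V. (y v)\<^sup>2) / n"
        using n by (simp add: z_def power_divide flip: sum_divide_distrib)
      then have "(\<Sum>v\<in>V. (z v)\<^sup>2) = 1" using n by (simp add: n_def)
      then have "z \<in> S" using n by (simp add: S_def z_def)
      have "quad_form d V z = quad_form d V y / n"
        using n by (simp add: quad_form_def z_def sum_divide_distrib flip: power2_eq_square)
      with max[OF \<open>z \<in> S\<close>] n show ?thesis by (simp add: field_simps)
    qed
  qed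
qed

text \<open>First-order optimality, for the situation where one coordinate of a maximizer is moved
  by \<open>t\<close>.\<close>

lemma linear_coefficient_zero:
  fixes \<alpha> \<beta> :: real
  assumes "\<And>t. 2 * t * \<alpha> + t\<^sup>2 * \<beta> \<le> 0"
  shows "\<alpha> = 0"
proof (rule ccontr)
  assume "\<alpha> \<noteq> 0"
  \<comment> \<open>\<open>B\<close> is large enough for the linear term to dominate the quadratic
    one at \<open>t = \<alpha> / B\<close>.\<close>
  define B where "B = \<bar>\<beta>\<bar> + 1"
  have B: "B > 0" "2 * B + \<beta> > 0" by (auto simp: B_def)
  have "2 * (\<alpha> / B) * \<alpha> + (\<alpha> / B)\<^sup>2 * \<beta> = \<alpha>\<^sup>2 * (2 * B + \<beta>) / B\<^sup>2"
    using B(1) by (simp add: field_simps power2_eq_square)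
  also have "\<dots> > 0" using B \<open>\<alpha> \<noteq> 0\<close> by (intro divide_pos_pos mult_pos_pos) auto
  finally show False using assms[of "\<alpha> / B"] by simp
qed

lemma quad_form_perturb:
  assumes "finite V" "c \<in> V" and sym: "\<And>a b. a \<in> V \<Longrightarrow> b \<in> V \<Longrightarrow> d a b = d b a"
  shows "quad_form d V (\<lambda>v. x v + (if v = c then t else 0)) =
    quad_form d V x + 2 * t * (\<Sum>b\<in>V. d c b * x b) + t\<^sup>2 * d c c"
proof -
  let ?i = "\<lambda>v. if v = c then t else 0"
  have shift: "(\<Sum>b\<in>V. f b * (x b + ?i b)) = (\<Sum>b\<in>V. f b * x b) + f c * t" for f
  proof -
    have "f b * (x b + ?i b) = f b * x b + (if b = c then f b * t else 0)" for b
      by (simp add: algebra_simps)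
    then show ?thesis using assms(1,2) by (simp add: sum.distrib)
  qed
  have "quad_form d V (\<lambda>v. x v + ?i v) =
      (\<Sum>a\<in>V. ((\<Sum>b\<in>V. d a b * x b) + d a c * t) * (x a + ?i a))"
    unfolding quad_form_def shift[symmetric] sum_distrib_right
    by (intro sum.cong refl) (simp only: mult_ac)
  also have "\<dots> = (\<Sum>a\<in>V. ((\<Sum>b\<in>V. d a b * x b) + d a c * t) * x a)
      + ((\<Sum>b\<in>V. d c b * x b) + d c c * t) * t"
    by (rule shift)
  also have "(\<Sum>a\<in>V. ((\<Sum>b\<in>V. d a b * x b) + d a c * t) * x a) =
      quad_form d V x + t * (\<Sum>a\<in>V. d a c * x a)"
    unfolding quad_form_def
    by (simp add: distrib_left distrib_right sum.distrib sum_distrib_left sum_distrib_right mult_ac)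
  also have "(\<Sum>a\<in>V. d a c * x a) = (\<Sum>b\<in>V. d c b * x b)"
    using sym assms(2) by (intro sum.cong) auto
  finally show ?thesis
    by (simp add: power2_eq_square algebra_simps)
qed

text \<open>Since \<open>d\<close> is nonnegative, taking absolute values of a maximizer does not
  decrease the form, so the result is again a maximizer. Varying one coordinate at a time yields the
  eigenvalue equation. A zero coordinate would force all the others to vanish, as the off-diagonal
  entries are positive.\<close>

lemma perron_vector:
  assumes fin: "finite V" and ne: "V \<noteq> {}"
    and sym: "\<And>a b. a \<in> V \<Longrightarrow> b \<in> V \<Longrightarrow> d a b = d b a"
    and nonneg: "\<And>a b. a \<in> V \<Longrightarrow> b \<in> V \<Longrightarrow> d a b \<ge> 0"
    and pos: "\<And>a b. a \<in> V \<Longrightarrow> b \<in> V \<Longrightarrow> a \<noteq> b \<Longrightarrow> d a b > 0"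
  obtains x M where "\<And>v. v \<in> V \<Longrightarrow> x v > 0"
    and "\<And>a. a \<in> V \<Longrightarrow> (\<Sum>b\<in>V. d a b * x b) = M * x a"
    and "\<And>y. quad_form d V y \<le> M * (\<Sum>v\<in>V. (y v)\<^sup>2)"
proof -
  obtain x where x: "(\<Sum>v\<in>V. (x v)\<^sup>2) = 1"
    and max: "\<And>y. quad_form d V y \<le> quad_form d V x * (\<Sum>v\<in>V. (y v)\<^sup>2)"
    using quad_form_maximizer[OF fin ne] by blast
  define M where "M = quad_form d V x"
  define z where "z v = \<bar>x v\<bar>" for v
  have z: "(\<Sum>v\<in>V. (z v)\<^sup>2) = 1" using x by (simp add: z_def)
  have "quad_form d V x \<le> quad_form d V z"
    unfolding quad_form_def z_def mult.assoc
    by (intro sum_mono mult_left_mono nonneg) (simp_all flip: abs_mult)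
  with max[of z] z have Mz: "quad_form d V z = M" by (simp add: M_def)
  have eig: "(\<Sum>b\<in>V. d c b * z b) = M * z c" if c: "c \<in> V" for c
  proof -
    \<comment> \<open>This is maximality of \<open>M\<close> tested on \<open>z\<close> with its
      coordinate \<open>c\<close> moved by \<open>t\<close>; the constant terms cancel.\<close>
    have "2 * t * ((\<Sum>b\<in>V. d c b * z b) - M * z c) + t\<^sup>2 * (d c c - M) \<le> 0" for t
    proof -
      let ?i = "\<lambda>v. if v = c then t else 0"
      have "(z v + ?i v)\<^sup>2 = (z v)\<^sup>2 + (if v = c then 2 * t * z v + t\<^sup>2 else 0)" for v
        by (simp add: power2_sum)
      then have "(\<Sum>v\<in>V. (z v + ?i v)\<^sup>2) = 1 + 2 * t * z c + t\<^sup>2"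
        using c fin z by (simp add: sum.distrib)
      moreover have "quad_form d V (\<lambda>v. z v + ?i v) = M + 2 * t * (\<Sum>b\<in>V. d c b * z b) + t\<^sup>2 * d c c"
        using quad_form_perturb[OF fin c sym, where x = z and t = t] Mz by simp
      ultimately show ?thesis
        using max[of "\<lambda>v. z v + ?i v"] unfolding M_def[symmetric] by (simp add: algebra_simps)
    qed
    then show ?thesis using linear_coefficient_zero by fastforce
  qed
  have "z v > 0" if v: "v \<in> V" for v
  proof (rule ccontr)
    assume "\<not> z v > 0"
    then have zv: "z v = 0" by (simp add: z_def)
    then have "(\<Sum>b\<in>V. d v b * z b) = 0" using eig[OF v] by simp
    then have "\<forall>b\<in>V. d v b * z b = 0"
      using fin nonneg v by (subst (asm) sum_nonneg_eq_0_iff) (auto simp: z_def)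
    then have "\<forall>b\<in>V. z b = 0" using pos[OF v] zv by fastforce
    with z show False by simp
  qed
  then show ?thesis using that[of z M] eig max unfolding M_def by blast
qed

section \<open>The distance spectral radius as the maximal Rayleigh quotient\<close>

definition metric_hypergraph :: "'a hypergraph \<Rightarrow> bool" where
  "metric_hypergraph H \<longleftrightarrow> hypergraph H \<and>
     (\<forall>a\<in>verts H. \<forall>b\<in>verts H. hdist H a b = hdist H b a \<and> (a \<noteq> b \<longrightarrow> hdist H a b > 0))"

text \<open>The Perron value is itself an eigenvalue, and evaluating the quadratic form at an
  arbitrary eigenvector shows that no eigenvalue exceeds it.\<close>

lemma distance_spectral_radius_perron:
  assumes "metric_hypergraph H"
  obtains x where "\<And>v. v \<in> verts H \<Longrightarrow> x v > 0"
    and "\<And>a. a \<in> verts H \<Longrightarrow>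
      (\<Sum>b\<in>verts H. real (hdist H a b) * x b) = distance_spectral_radius H * x a"
    and "\<And>y. quad_form (\<lambda>a b. real (hdist H a b)) (verts H) y
      \<le> distance_spectral_radius H * (\<Sum>v\<in>verts H. (y v)\<^sup>2)"
proof -
  let ?V = "verts H" and ?d = "\<lambda>a b. real (hdist H a b)"
  have H: "hypergraph H" "finite ?V" "?V \<noteq> {}"
    using assms by (auto simp: metric_hypergraph_def hypergraph_def)
  obtain x M where x: "\<And>v. v \<in> ?V \<Longrightarrow> x v > 0"
    and eig: "\<And>a. a \<in> ?V \<Longrightarrow> (\<Sum>b\<in>?V. ?d a b * x b) = M * x a"
    and max: "\<And>y. quad_form ?d ?V y \<le> M * (\<Sum>v\<in>?V. (y v)\<^sup>2)"
  proof (rule perron_vector[OF H(2,3), of ?d])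
    show "?d a b = ?d b a" if "a \<in> ?V" "b \<in> ?V" for a b
      using assms that by (simp add: metric_hypergraph_def)
    show "?d a b > 0" if "a \<in> ?V" "b \<in> ?V" "a \<noteq> b" for a b
      using assms that by (simp add: metric_hypergraph_def)
  qed (simp, rule that)
  have "distance_spectral_radius H = M"
    unfolding distance_spectral_radius_def
  proof (rule Max_eqI)
    have A: "distance_matrix H \<in> carrier_mat (card ?V) (card ?V)"
      by (simp add: distance_matrix_def)
    \<comment> \<open>\<open>Max\<close> needs a finite set; the eigenvalues are the roots of a
      nonzero polynomial.\<close>
    have "char_poly (distance_matrix H) \<noteq> 0"
      using degree_monic_char_poly[OF A] by auto
    then show "finite {\<mu>. eigenvalue (distance_matrix H) \<mu>}"
      unfolding eigenvalue_root_char_poly[OF A] by (rule poly_roots_finite)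
    have "\<exists>v\<in>?V. x v \<noteq> 0" using H(3) x by force
    then show "M \<in> {\<mu>. eigenvalue (distance_matrix H) \<mu>}"
      using eig unfolding mem_Collect_eq eigenvalue_distance_matrix_iff[OF H(1)] by blast
    fix \<mu> assume "\<mu> \<in> {\<mu>. eigenvalue (distance_matrix H) \<mu>}"
    then obtain y where y: "\<exists>v\<in>?V. y v \<noteq> 0"
      and eq: "\<forall>a\<in>?V. (\<Sum>b\<in>?V. ?d a b * y b) = \<mu> * y a"
      unfolding mem_Collect_eq eigenvalue_distance_matrix_iff[OF H(1)] by blast
    have "quad_form ?d ?V y = \<mu> * (\<Sum>v\<in>?V. (y v)\<^sup>2)"
      by (rule quad_form_eigenvector) (use eq in blast)
    then have "\<mu> * (\<Sum>v\<in>?V. (y v)\<^sup>2) \<le> M * (\<Sum>v\<in>?V. (y v)\<^sup>2)" using max[of y] by simp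
    moreover have "(\<Sum>v\<in>?V. (y v)\<^sup>2) > 0"
      using y H(2) by (auto intro: sum_pos2)
    ultimately show "\<mu> \<le> M" by simp
  qed
  then show ?thesis using that x eig max by blast
qed

lemma quad_form_reindex:
  assumes "bij_betw \<phi> V W"
  shows "quad_form d W x = quad_form (\<lambda>a b. d (\<phi> a) (\<phi> b)) V (\<lambda>v. x (\<phi> v))"
  unfolding quad_form_def
  by (simp add: sum.reindex_bij_betw[OF assms, symmetric])

text \<open>Applied below with \<open>V\<close> the vertex set of another hypergraph, whose Perron
  vector then serves as a test vector for \<open>H\<close>.\<close>

lemma rayleigh_reindexed:
  assumes "metric_hypergraph H" and \<phi>: "bij_betw \<phi> V (verts H)"
  shows "quad_form (\<lambda>a b. real (hdist H (\<phi> a) (\<phi> b))) V x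
    \<le> distance_spectral_radius H * (\<Sum>v\<in>V. (x v)\<^sup>2)"
proof -
  define y where "y = x \<circ> the_inv_into V \<phi>"
  have y: "y (\<phi> v) = x v" if "v \<in> V" for v
    using \<phi> that by (simp add: y_def bij_betw_def the_inv_into_f_f)
  obtain z :: "'b \<Rightarrow> real" where "\<And>y. quad_form (\<lambda>a b. real (hdist H a b)) (verts H) y
      \<le> distance_spectral_radius H * (\<Sum>v\<in>verts H. (y v)\<^sup>2)"
    using distance_spectral_radius_perron[OF assms(1)] by blast
  from this[of y] show ?thesis
    unfolding quad_form_reindex[OF \<phi>]
    by (simp add: sum.reindex_bij_betw[OF \<phi>, symmetric] quad_form_def y)
qed

section \<open>Distances\<close>

text \<open>Excluding equal endpoints matches the condition on consecutive vertices of a walk, so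
  the \<open>n\<close>-th relational power relates the ends of walks of length exactly
  \<open>n\<close>.\<close>

definition adjacency :: "'a hypergraph \<Rightarrow> 'a rel" where
  "adjacency H = {(a, b). a \<in> verts H \<and> b \<in> verts H \<and> a \<noteq> b \<and> (\<exists>e\<in>edges H. a \<in> e \<and> b \<in> e)}"

lemma adjacency_sym: "(a, b) \<in> adjacency H \<Longrightarrow> (b, a) \<in> adjacency H"
  by (auto simp: adjacency_def)

lemma adjacency_relpow_sym: "(a, b) \<in> adjacency H ^^ n \<Longrightarrow> (b, a) \<in> adjacency H ^^ n"
proof (induction n arbitrary: b)
  case (Suc n)
  then obtain c where "(a, c) \<in> adjacency H ^^ n" "(c, b) \<in> adjacency H" by auto
  then show ?case using Suc.IH adjacency_sym by (metis relpow_Suc_I2)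
qed simp

lemma walk_imp_relpow:
  assumes "is_walk H a vs es b"
  shows "(a, b) \<in> adjacency H ^^ length es"
  unfolding relpow_fun_conv
proof (intro exI conjI allI impI)
  have vs: "vs \<noteq> []" using assms by (auto simp: is_walk_def)
  show "vs ! 0 = a" using assms vs by (auto simp: is_walk_def hd_conv_nth)
  show "vs ! length es = b" using assms vs by (auto simp: is_walk_def last_conv_nth)
  fix i assume i: "i < length es"
  then have "vs ! i \<in> verts H" "vs ! Suc i \<in> verts H" "es ! i \<in> edges H"
    using assms by (simp_all add: is_walk_def subset_iff)
  moreover have "vs ! i \<in> es ! i" "vs ! Suc i \<in> es ! i" "vs ! i \<noteq> vs ! Suc i"
    using assms i by (simp_all add: is_walk_def)
  ultimately show "(vs ! i, vs ! Suc i) \<in> adjacency H"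
    unfolding adjacency_def by blast
qed

text \<open>On a shortest walk the \<open>i\<close>-th vertex is at distance \<open>i\<close> from the start, so neither a vertex
  nor an edge can be repeated.\<close>

lemma shortest_walk_is_path:
  assumes n: "(a, b) \<in> adjacency H ^^ n" and min: "\<And>m. (a, b) \<in> adjacency H ^^ m \<Longrightarrow> n \<le> m"
    and a: "a \<in> verts H"
  shows "\<exists>vs es. is_path H a vs es b \<and> length es = n"
proof -
  obtain f where f: "f 0 = a" "f n = b" and step: "\<And>i. i < n \<Longrightarrow> (f i, f (Suc i)) \<in> adjacency H"
    using n unfolding relpow_fun_conv by blast
  have "\<exists>e. i < n \<longrightarrow> e \<in> edges H \<and> f i \<in> e \<and> f (Suc i) \<in> e" for i
    using step[of i] by (auto simp: adjacency_def)
  then obtain g where g: "\<And>i. i < n \<Longrightarrow> g i \<in> edges H \<and> f i \<in> g i \<and> f (Suc i) \<in> g i"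
    by metis
  have V: "f i \<in> verts H" if "i \<le> n" for i
    using that step[of "i - 1"] a f by (cases i) (auto simp: adjacency_def)
  have to: "(a, f i) \<in> adjacency H ^^ i" if "i \<le> n" for i
    unfolding relpow_fun_conv using that f step by (intro exI[of _ f]) auto
  have onward: "(f i, b) \<in> adjacency H ^^ (n - i)" if "i \<le> n" for i
    unfolding relpow_fun_conv using that f step by (intro exI[of _ "\<lambda>j. f (i + j)"]) auto
  \<comment> \<open>A quicker way to \<open>f i\<close>, continued along \<open>f\<close>, would
    reach \<open>b\<close> in fewer than \<open>n\<close> steps.\<close>
  have far: "i \<le> l" if "i \<le> n" "(a, f i) \<in> adjacency H ^^ l" for i l
  proof -
    have "(a, b) \<in> adjacency H ^^ (l + (n - i))"
      unfolding relpow_add using that(2) onward[OF that(1)] by (rule relcompI)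
    then show ?thesis using min that(1) by fastforce
  qed
  have f_inj: "i = j" if "i \<le> n" "j \<le> n" "f i = f j" for i j
    using that to far by (metis le_antisym)
  have g_inj: "\<not> i < j" if "i < n" "j < n" "g i = g j" for i j
  proof
    \<comment> \<open>A repeated edge contains both \<open>f i\<close> and \<open>f (Suc j)\<close>,
      hence is a shortcut reaching \<open>f (Suc j)\<close> after \<open>Suc i\<close>
      steps.\<close>
    assume "i < j"
    then have "f i \<noteq> f (Suc j)" using f_inj[of i "Suc j"] that by auto
    then have "(f i, f (Suc j)) \<in> adjacency H"
      using g[of i] g[of j] that V by (auto simp: adjacency_def)
    then have "(a, f (Suc j)) \<in> adjacency H ^^ Suc i" using to[of i] that by auto
    then show False using far[of "Suc j" "Suc i"] that \<open>i < j\<close> by simp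
  qed
  have "is_path H a (map f [0..<Suc n]) (map g [0..<n]) b"
    unfolding is_path_def is_walk_def
  proof (intro conjI)
    show "hd (map f [0..<Suc n]) = a" using f by (simp add: hd_map del: upt_Suc)
    show "set (map f [0..<Suc n]) \<subseteq> verts H" using V by auto
    show "set (map g [0..<n]) \<subseteq> edges H" using g by auto
    show "distinct (map f [0..<Suc n])"
      using f_inj by (auto simp: distinct_map inj_on_def simp del: upt_Suc)
    show "distinct (map g [0..<n])"
      unfolding distinct_map inj_on_def
    proof (intro conjI ballI impI)
      show "i = j" if "i \<in> set [0..<n]" "j \<in> set [0..<n]" "g i = g j" for i j
        using g_inj[of i j] g_inj[of j i] that by simp
    qed simp
    have "f i \<noteq> f (Suc i)" if "i < n" for i
      using step[OF that] by (simp add: adjacency_def)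
    then show "\<forall>i<length (map g [0..<n]). map f [0..<Suc n] ! i \<in> map g [0..<n] ! i \<and>
        map f [0..<Suc n] ! (i + 1) \<in> map g [0..<n] ! i \<and>
        map f [0..<Suc n] ! i \<noteq> map f [0..<Suc n] ! (i + 1)"
      using g by (simp del: upt_Suc)
    show "last (map f [0..<Suc n]) = b" using f by simp
  qed simp_all
  then show ?thesis
    by (intro exI[of _ "map f [0..<Suc n]"] exI[of _ "map g [0..<n]"]) simp
qed

text \<open>Replaces paths by walks: every path is a walk, and a shortest walk is a path.\<close>

lemma hdist_eqI:
  assumes n: "(a, b) \<in> adjacency H ^^ n" and min: "\<And>m. (a, b) \<in> adjacency H ^^ m \<Longrightarrow> n \<le> m"
    and a: "a \<in> verts H"
  shows "hdist H a b = n"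
  unfolding hdist_def
proof (rule Least_equality)
  show "\<exists>vs es. is_path H a vs es b \<and> length es = n"
    using assms by (rule shortest_walk_is_path)
  show "n \<le> m" if "\<exists>vs es. is_path H a vs es b \<and> length es = m" for m
    using that min walk_imp_relpow[of H a _ _ b] unfolding is_path_def by (elim exE conjE) force
qed

section \<open>Distances in connected hypergraphs\<close>

lemma hdist_connected:
  assumes "connected_hypergraph G" "a \<in> verts G" "b \<in> verts G"
  shows "(a, b) \<in> adjacency G ^^ hdist G a b"
    and "(a, b) \<in> adjacency G ^^ m \<Longrightarrow> hdist G a b \<le> m"
proof -
  define n where "n = (LEAST n. (a, b) \<in> adjacency G ^^ n)"
  obtain vs es where "is_path G a vs es b"
    using assms unfolding connected_hypergraph_def by blast
  then have "(a, b) \<in> adjacency G ^^ length es"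
    unfolding is_path_def by (intro walk_imp_relpow[where vs = vs]) simp
  then have n: "(a, b) \<in> adjacency G ^^ n" unfolding n_def by (rule LeastI)
  have min: "n \<le> m" if "(a, b) \<in> adjacency G ^^ m" for m
    unfolding n_def using that by (rule Least_le)
  have "hdist G a b = n" using n min assms(2) by (rule hdist_eqI)
  then show "(a, b) \<in> adjacency G ^^ hdist G a b"
    and "(a, b) \<in> adjacency G ^^ m \<Longrightarrow> hdist G a b \<le> m"
    using n min by simp_all
qed

lemma hdist_sym:
  assumes "connected_hypergraph G" "a \<in> verts G" "b \<in> verts G"
  shows "hdist G a b = hdist G b a"
  using assms hdist_connected adjacency_relpow_sym by (metis le_antisym)

lemma hdist_eq_0_iff:
  assumes "connected_hypergraph G" "a \<in> verts G" "b \<in> verts G"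
  shows "hdist G a b = 0 \<longleftrightarrow> a = b"
  using hdist_connected(1)[OF assms] hdist_connected(2)[OF assms, of 0] by auto

lemma hdist_adjacent_le:
  assumes "connected_hypergraph G" "a \<in> verts G" "(x, y) \<in> adjacency G"
  shows "hdist G a y \<le> hdist G a x + 1"
proof -
  have "x \<in> verts G" "y \<in> verts G" using assms(3) by (auto simp: adjacency_def)
  then have "(a, y) \<in> adjacency G ^^ (hdist G a x + 1)"
    using hdist_connected(1)[OF assms(1,2)] assms(3) by auto
  then show ?thesis using hdist_connected(2)[OF assms(1,2)] \<open>y \<in> verts G\<close> by blast
qed

lemma hdist_predecessor:
  assumes "connected_hypergraph G" "a \<in> verts G" "b \<in> verts G" "a \<noteq> b"
  obtains y where "(y, b) \<in> adjacency G" "hdist G a y < hdist G a b"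
proof -
  obtain n where n: "hdist G a b = Suc n"
    using hdist_eq_0_iff[OF assms(1-3)] assms(4) by (cases "hdist G a b") auto
  then obtain y where y: "(a, y) \<in> adjacency G ^^ n" "(y, b) \<in> adjacency G"
    using hdist_connected(1)[OF assms(1-3)] by auto
  then have "hdist G a y \<le> n"
    using hdist_connected(2)[OF assms(1,2)] by (auto simp: adjacency_def)
  then show ?thesis using that y n by auto
qed

text \<open>The Lipschitz condition \<open>lip\<close> makes \<open>\<delta>\<close> a lower bound
  for the length of any walk, and the descent \<open>closer\<close> builds a walk of that length. By
  symmetry the descent may move whichever endpoint is convenient.\<close>

lemma hdist_eq:
  fixes \<delta> :: "'a \<Rightarrow> 'a \<Rightarrow> nat"
  assumes refl: "\<And>a. \<delta> a a = 0"
    and sym: "\<And>a b. a \<in> verts H \<Longrightarrow> b \<in> verts H \<Longrightarrow> \<delta> a b = \<delta> b a"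
    and lip: "\<And>a x y. a \<in> verts H \<Longrightarrow> (x, y) \<in> adjacency H \<Longrightarrow> \<delta> a y \<le> \<delta> a x + 1"
    and closer: "\<And>a b. a \<in> verts H \<Longrightarrow> b \<in> verts H \<Longrightarrow> a \<noteq> b \<Longrightarrow>
      (\<exists>y. (y, b) \<in> adjacency H \<and> \<delta> a y < \<delta> a b) \<or> (\<exists>y. (y, a) \<in> adjacency H \<and> \<delta> b y < \<delta> b a)"
    and "a \<in> verts H" "b \<in> verts H"
  shows "hdist H a b = \<delta> a b"
proof (rule hdist_eqI)
  show "(a, b) \<in> adjacency H ^^ \<delta> a b"
    using assms(5,6)
  proof (induction "\<delta> a b" arbitrary: a b rule: less_induct)
    case less
    have extend: "(a, b) \<in> adjacency H ^^ \<delta> a b"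
      if ab: "a \<in> verts H" and y: "(y, b) \<in> adjacency H" "\<delta> a y < \<delta> a b"
        and IH: "(a, y) \<in> adjacency H ^^ \<delta> a y" for a b y
    proof -
      \<comment> \<open>The strict descent cannot exceed one because of \<open>lip\<close>, so one
        more step gives exactly the required length.\<close>
      have "\<delta> a b = Suc (\<delta> a y)" using lip[OF ab y(1)] y(2) by simp
      then show ?thesis using y IH by auto
    qed
    show ?case
    proof (cases "a = b")
      case True
      then show ?thesis using refl by simp
    next
      case False
      then consider y where "(y, b) \<in> adjacency H" "\<delta> a y < \<delta> a b"
        | y where "(y, a) \<in> adjacency H" "\<delta> b y < \<delta> b a"
        using closer less.prems by blast
      then show ?thesis
      proof cases
        case 1
        then have "(a, y) \<in> adjacency H ^^ \<delta> a y"
          using less by (auto simp: adjacency_def)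
        then show ?thesis using extend less.prems 1 by blast
      next
        case 2
        then have "(b, y) \<in> adjacency H ^^ \<delta> b y"
          using less sym[of a b] by (auto simp: adjacency_def)
        then have "(b, a) \<in> adjacency H ^^ \<delta> b a" using extend less.prems 2 by blast
        then show ?thesis using less.prems sym[of a b] adjacency_relpow_sym by auto
      qed
    qed
  qed
  show "\<delta> a b \<le> m" if "(a, b) \<in> adjacency H ^^ m" for m
    using that
  proof (induction m arbitrary: b)
    case (Suc m)
    then obtain c where c: "(a, c) \<in> adjacency H ^^ m" "(c, b) \<in> adjacency H" by auto
    with Suc.IH[of c] lip[OF \<open>a \<in> verts H\<close> c(2)] show ?case by simp
  qed (simp add: refl)
qed fact

section \<open>Two pendant paths at one vertex\<close>

lemma verts_attach_two [simp]:
  "Base w \<in> verts (attach_two k G u p q) \<longleftrightarrow> w \<in> verts G"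
  "New s i j \<in> verts (attach_two k G u p q) \<longleftrightarrow>
     j < k - 1 \<and> 1 \<le> i \<and> (s = 0 \<and> i \<le> p \<or> s = 1 \<and> i \<le> q)"
  by (auto simp: attach_two_def new_vertices_def)

text \<open>The two pendant paths together form one loose path. Its joints are placed at the integers,
  with \<open>u\<close> at \<open>0\<close>, path number \<open>0\<close> on the negative and path number \<open>1\<close> on the positive side; a
  vertex that is not a joint occupies the unit interval of its edge. The distance of two distinct
  path vertices is the length of the hull of their intervals \<open>[lo, hi]\<close>.\<close>

fun lo :: "'a pendant_vertex \<Rightarrow> int" where
  "lo (Base w) = 0"
| "lo (New s i j) = (if s = 0 then - int i else if j = 0 then int i else int i - 1)"

fun hi :: "'a pendant_vertex \<Rightarrow> int" where
  "hi (Base w) = 0"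
| "hi (New s i j) = (if s = 0 then if j = 0 then - int i else 1 - int i else int i)"

fun projection :: "'a \<Rightarrow> 'a pendant_vertex \<Rightarrow> 'a" where
  "projection u (Base w) = w"
| "projection u (New s i j) = u"

text \<open>Pendant vertices reach \<open>G\<close> only through \<open>u\<close>, so a part inside
  \<open>G\<close> and a part along the path add up. The case \<open>a = b\<close> is separate
  because the interval of a vertex that is not a joint has length 1.\<close>

definition attach_dist :: "'a hypergraph \<Rightarrow> 'a \<Rightarrow> 'a pendant_vertex \<Rightarrow> 'a pendant_vertex \<Rightarrow> nat" where
  "attach_dist G u a b = (if a = b then 0 else
     hdist G (projection u a) (projection u b) + nat (max (hi a) (hi b) - min (lo a) (lo b)))"

lemma lo_hi: "lo a \<le> hi a" "hi a \<le> lo a + 1"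
  by (cases a; simp)+

text \<open>Here \<open>t\<close> is the left end of the unit interval occupied by the edge; a step
  within the edge therefore changes the length of a hull by at most one.\<close>

lemma pendant_edge_bounds:
  assumes "x \<in> pendant_edge k u s i" "i \<ge> 1"
  defines "t \<equiv> if s = 0 then - int i else int i - 1"
  shows "projection u x = u" "t \<le> lo x" "hi x \<le> t + 1"
  using assms by (auto simp: pendant_edge_def joint_def new_vertices_def split: if_splits)

text \<open>Selects the endpoint that moves in the descent: the one further out on its path.\<close>

fun level :: "'a pendant_vertex \<Rightarrow> nat" where
  "level (Base w) = 0"
| "level (New s i j) = i"

section \<open>Distances after attaching the pendant paths\<close>

locale pendant_paths =
  fixes G :: "'a hypergraph" and u :: 'a and k :: nat
  assumes k: "k \<ge> 2" and G: "hypergraph G" and conn: "connected_hypergraph G" and u: "u \<in> verts G"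
begin

abbreviation H :: "nat \<Rightarrow> nat \<Rightarrow> 'a pendant_vertex hypergraph" where
  "H \<equiv> attach_two k G u"

lemma projection_in_verts: "a \<in> verts (H p q) \<Longrightarrow> projection u a \<in> verts G"
  using u by (cases a) auto

lemma hdist_self: "a \<in> verts G \<Longrightarrow> hdist G a a = 0"
  using hdist_eq_0_iff[OF conn] by blast

lemma pendant_edge_subset_verts:
  assumes "s = 0 \<and> i \<in> {1..p} \<or> s = 1 \<and> i \<in> {1..q}"
  shows "pendant_edge k u s i \<subseteq> verts (H p q)"
  using assms k u by (auto simp: pendant_edge_def joint_def new_vertices_def)

lemma hypergraph_attach_two: "hypergraph (H p q)"
proof -
  have fin: "finite (verts (H p q))"
    using G by (auto simp: attach_two_def hypergraph_def card_new_vertices)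
  have "e \<noteq> {} \<and> e \<subseteq> verts (H p q)" if "e \<in> edges (H p q)" for e
  proof -
    consider e' where "e' \<in> edges G" "e = Base ` e'"
      | i where "i \<in> {1..p}" "e = pendant_edge k u 0 i"
      | i where "i \<in> {1..q}" "e = pendant_edge k u 1 i"
      using \<open>e \<in> edges (H p q)\<close> unfolding attach_two_def by auto
    then show ?thesis
    proof cases
      case 1
      then have "e' \<noteq> {}" "e' \<subseteq> verts G" using G by (simp_all add: hypergraph_def)
      then show ?thesis using 1 by auto
    next
      case 2
      then show ?thesis
        using pendant_edge_subset_verts[of 0 i p q] by (simp add: pendant_edge_def)
    next
      case 3
      then show ?thesis
        using pendant_edge_subset_verts[of 1 i p q] by (simp add: pendant_edge_def)
    qed
  qed
  moreover have "Base u \<in> verts (H p q)" using u by simp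
  ultimately show ?thesis using fin unfolding hypergraph_def by blast
qed

lemma adjacency_attach_two:
  assumes "(x, y) \<in> adjacency (H p q)"
  obtains w w' where "x = Base w" "y = Base w'" "(w, w') \<in> adjacency G"
  | s i where "i \<ge> 1" "x \<in> pendant_edge k u s i" "y \<in> pendant_edge k u s i"
proof -
  obtain e where e: "e \<in> edges (H p q)" "x \<in> e" "y \<in> e" and xy: "x \<noteq> y"
    using assms by (auto simp: adjacency_def)
  consider e' where "e' \<in> edges G" "e = Base ` e'"
      | s i where "i \<ge> 1" "e = pendant_edge k u s i"
      using e(1) by (auto simp: attach_two_def)
  then show ?thesis
  proof cases
    case 1
    then obtain w w' where "x = Base w" "y = Base w'" "w \<in> e'" "w' \<in> e'" using e by auto
    moreover have "e' \<subseteq> verts G" using G 1 by (simp add: hypergraph_def)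
    ultimately show ?thesis using that(1)[of w w'] 1(1) xy by (auto simp: adjacency_def)
  next
    case 2
    then show ?thesis using that(2) e by blast
  qed
qed

lemma adjacency_Base: "(w, w') \<in> adjacency G \<Longrightarrow> (Base w, Base w') \<in> adjacency (H p q)"
  by (auto simp: adjacency_def attach_two_def)

lemma adjacency_pendant:
  assumes "s = 0 \<and> i \<in> {1..p} \<or> s = 1 \<and> i \<in> {1..q}"
    and "x \<in> pendant_edge k u s i" "y \<in> pendant_edge k u s i" "x \<noteq> y"
  shows "(x, y) \<in> adjacency (H p q)"
proof -
  have "pendant_edge k u s i \<in> edges (H p q)" using assms(1) by (auto simp: attach_two_def)
  then show ?thesis
    using assms pendant_edge_subset_verts[OF assms(1)] unfolding adjacency_def by blast
qed

text \<open>A step inside \<open>G\<close> leaves the hull unchanged, while a step inside a pendant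
  edge leaves the projection unchanged.\<close>

lemma attach_dist_adjacent_le:
  assumes a: "a \<in> verts (H p q)" and xy: "(x, y) \<in> adjacency (H p q)"
  shows "attach_dist G u a y \<le> attach_dist G u a x + 1"
  using xy
proof (cases rule: adjacency_attach_two)
  case (1 w w')
  have "w \<in> verts G" "w' \<in> verts G" using 1(3) by (auto simp: adjacency_def)
  moreover have "hdist G (projection u a) w' \<le> hdist G (projection u a) w + 1"
    using hdist_adjacent_le[OF conn projection_in_verts[OF a] 1(3)] .
  ultimately show ?thesis
    using 1 hdist_self by (auto simp: attach_dist_def)
next
  case (2 s i)
  note B = pendant_edge_bounds[OF 2(2,1)] pendant_edge_bounds[OF 2(3,1)]
  show ?thesis
    using B lo_hi[of a] lo_hi[of x] lo_hi[of y] hdist_self[OF u]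
    by (auto simp: attach_dist_def)
qed

text \<open>If \<open>b\<close> lies in \<open>G\<close>, then so does \<open>a\<close>, and the
  descent takes place in \<open>G\<close>. Otherwise \<open>b\<close> moves to the previous joint of
  its path, unless \<open>a\<close> is a new vertex of the same edge.\<close>

lemma attach_dist_closer:
  assumes a: "a \<in> verts (H p q)" and b: "b \<in> verts (H p q)" and "a \<noteq> b" and lev: "level a \<le> level b"
  shows "\<exists>y. (y, b) \<in> adjacency (H p q) \<and> attach_dist G u a y < attach_dist G u a b"
proof (cases b)
  case (Base w)
  then obtain w' where w': "a = Base w'" "w' \<noteq> w" "w' \<in> verts G" "w \<in> verts G"
    using lev \<open>a \<noteq> b\<close> a b by (cases a) auto
  then obtain y where y: "(y, w) \<in> adjacency G" "hdist G w' y < hdist G w' w"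
    using hdist_predecessor[OF conn] by metis
  then show ?thesis
    using w' Base by (intro exI[of _ "Base y"]) (auto simp: attach_dist_def adjacency_Base)
next
  case (New s i j)
  have side: "s = 0 \<and> i \<in> {1..p} \<or> s = 1 \<and> i \<in> {1..q}" and j: "j < k - 1"
    using b New by auto
  have b_edge: "b \<in> pendant_edge k u s i"
    using j by (simp add: New pendant_edge_def new_vertices_def)
  have pos: "attach_dist G u a b > 0"
    using \<open>a \<noteq> b\<close> New side a
    by (cases a) (auto simp: attach_dist_def)
  \<comment> \<open>Two new vertices of one edge are adjacent, and the detour through the previous
    joint would not bring them closer.\<close>
  show ?thesis
  proof (cases "\<exists>j'. a = New s i j'")
    case True
    then have "a \<in> pendant_edge k u s i" using a by (auto simp: pendant_edge_def new_vertices_def)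
    then have "(a, b) \<in> adjacency (H p q)"
      using adjacency_pendant[OF side _ b_edge] \<open>a \<noteq> b\<close> by blast
    then show ?thesis using pos by (intro exI[of _ a]) (simp add: attach_dist_def)
  next
    case False
    let ?y = "joint u s (i - 1) :: 'a pendant_vertex"
    have "?y \<noteq> b" using New side by (auto simp: joint_def)
    then have "(?y, b) \<in> adjacency (H p q)"
      by (intro adjacency_pendant[OF side _ b_edge]) (simp_all add: pendant_edge_def)
    moreover have "attach_dist G u a ?y < attach_dist G u a b"
    proof (cases "a = ?y")
      case True
      then show ?thesis using pos by (simp add: attach_dist_def)
    next
      case ne: False
      show ?thesis
        using ne False \<open>a \<noteq> b\<close> New side a lev
        by (cases a) (auto simp: attach_dist_def joint_def)
    qed
    ultimately show ?thesis by blast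
  qed
qed

lemma hdist_attach_two:
  assumes "a \<in> verts (H p q)" "b \<in> verts (H p q)"
  shows "hdist (H p q) a b = attach_dist G u a b"
proof (rule hdist_eq)
  show sym: "attach_dist G u a b = attach_dist G u b a"
    if "a \<in> verts (H p q)" "b \<in> verts (H p q)" for a b
    using that hdist_sym[OF conn projection_in_verts projection_in_verts]
    by (auto simp: attach_dist_def max.commute min.commute)
  show "attach_dist G u a a = 0" for a by (simp add: attach_dist_def)
  show "(\<exists>y. (y, b) \<in> adjacency (H p q) \<and> attach_dist G u a y < attach_dist G u a b) \<or>
      (\<exists>y. (y, a) \<in> adjacency (H p q) \<and> attach_dist G u b y < attach_dist G u b a)"
    if "a \<in> verts (H p q)" "b \<in> verts (H p q)" "a \<noteq> b" for a b
    using that attach_dist_closer[of a p q b] attach_dist_closer[of b p q a] linear by metis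
qed (use assms attach_dist_adjacent_le in blast)+

lemma metric_attach_two: "metric_hypergraph (H p q)"
proof -
  have "hdist (H p q) a b = hdist (H p q) b a \<and> (a \<noteq> b \<longrightarrow> hdist (H p q) a b > 0)"
    if ab: "a \<in> verts (H p q)" "b \<in> verts (H p q)" for a b
  proof -
    have sym: "attach_dist G u a b = attach_dist G u b a"
      using ab hdist_sym[OF conn projection_in_verts projection_in_verts]
      by (auto simp: attach_dist_def max.commute min.commute)
    moreover have "attach_dist G u a b > 0" if "a \<noteq> b"
      using attach_dist_closer[of a p q b] attach_dist_closer[of b p q a] that ab sym
      by (metis linear not_less_zero gr0I)
    ultimately show ?thesis using ab by (simp add: hdist_attach_two)
  qed
  then show ?thesis using hypergraph_attach_two by (simp add: metric_hypergraph_def)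
qed

end

section \<open>Moving the base hypergraph along the path\<close>

text \<open>Numbering the path vertices again after \<open>G\<close> has been moved one joint towards the end of path
  number \<open>1\<close>: the joint that was \<open>u\<close> becomes a new vertex, and the joint that becomes \<open>u\<close> is the
  one numbered \<open>New 1 1 0\<close> before.\<close>

fun shift :: "'a \<Rightarrow> 'a pendant_vertex \<Rightarrow> 'a pendant_vertex" where
  "shift u (Base w) = (if w = u then New 0 1 0 else Base w)"
| "shift u (New s i j) = (if s = 0 then New 0 (i + 1) j
     else if i = 1 then if j = 0 then Base u else New 0 1 j else New 1 (i - 1) j)"

fun unshift :: "'a \<Rightarrow> 'a pendant_vertex \<Rightarrow> 'a pendant_vertex" where
  "unshift u (Base w) = (if w = u then New 1 1 0 else Base w)"
| "unshift u (New s i j) = (if s \<noteq> 0 then New 1 (i + 1) j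
     else if i = 1 then if j = 0 then Base u else New 1 1 j else New 0 (i - 1) j)"

fun swap_paths :: "'a pendant_vertex \<Rightarrow> 'a pendant_vertex" where
  "swap_paths (Base w) = Base w"
| "swap_paths (New s i j) = New (1 - s) i j"

text \<open>The sign is opposite to the orientation of \<open>lo\<close> and \<open>hi\<close>: path
  number \<open>0\<close> is the side left behind by \<open>shift\<close>, where distances to
  \<open>G\<close> grow.\<close>

fun side_sign :: "'a pendant_vertex \<Rightarrow> real" where
  "side_sign (Base w) = 0"
| "side_sign (New s i j) = (if s = 0 then 1 else -1)"

context pendant_paths
begin

abbreviation radius :: "nat \<Rightarrow> nat \<Rightarrow> real" where
  "radius p q \<equiv> distance_spectral_radius (H p q)"

abbreviation D :: "nat \<Rightarrow> nat \<Rightarrow> 'a pendant_vertex \<Rightarrow> 'a pendant_vertex \<Rightarrow> real" where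
  "D p q a b \<equiv> real (hdist (H p q) a b)"

lemma finite_verts: "finite (verts (H p q))"
  using hypergraph_attach_two by (simp add: hypergraph_def)

lemma bij_shift:
  assumes "q \<ge> 1"
  shows "bij_betw (shift u) (verts (H p q)) (verts (H (p + 1) (q - 1)))"
proof (rule bij_betw_byWitness[where f' = "unshift u"])
  show "\<forall>a\<in>verts (H p q). unshift u (shift u a) = a"
  proof
    fix a assume "a \<in> verts (H p q)"
    then show "unshift u (shift u a) = a" by (cases a) auto
  qed
  show "\<forall>a\<in>verts (H (p + 1) (q - 1)). shift u (unshift u a) = a"
  proof
    fix a assume "a \<in> verts (H (p + 1) (q - 1))"
    then show "shift u (unshift u a) = a" by (cases a) auto
  qed
  show "shift u ` verts (H p q) \<subseteq> verts (H (p + 1) (q - 1))"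
  proof
    fix b assume "b \<in> shift u ` verts (H p q)"
    then obtain a where "a \<in> verts (H p q)" "b = shift u a" by blast
    then show "b \<in> verts (H (p + 1) (q - 1))" using u k by (cases a) auto
  qed
  show "unshift u ` verts (H (p + 1) (q - 1)) \<subseteq> verts (H p q)"
  proof
    fix b assume "b \<in> unshift u ` verts (H (p + 1) (q - 1))"
    then obtain a where "a \<in> verts (H (p + 1) (q - 1))" "b = unshift u a" by blast
    then show "b \<in> verts (H p q)" using u k assms by (cases a) auto
  qed
qed

lemma bij_swap_paths: "bij_betw swap_paths (verts (H p q)) (verts (H q p))"
proof (rule bij_betw_byWitness[where f' = swap_paths])
  have inv: "swap_paths (swap_paths a) = a" if "a \<in> verts (H p q)" for a p q
    using that by (cases a) auto
  then show "\<forall>a\<in>verts (H p q). swap_paths (swap_paths a) = a"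
    and "\<forall>a\<in>verts (H q p). swap_paths (swap_paths a) = a" by blast+
  have sub: "swap_paths a \<in> verts (H q p)" if "a \<in> verts (H p q)" for a p q
    using that by (cases a) auto
  then show "swap_paths ` verts (H p q) \<subseteq> verts (H q p)"
    and "swap_paths ` verts (H q p) \<subseteq> verts (H p q)" by blast+
qed

lemma D_swap_paths:
  assumes "a \<in> verts (H p q)" "b \<in> verts (H p q)"
  shows "D q p (swap_paths a) (swap_paths b) = D p q a b"
proof -
  have neg: "lo (swap_paths a) = - hi a" "hi (swap_paths a) = - lo a"
    "projection u (swap_paths a) = projection u a" if "a \<in> verts (H p q)" for a
    using that by (cases a; auto)+
  have "swap_paths a = swap_paths b \<longleftrightarrow> a = b"
    using bij_swap_paths[of p q] assms by (auto simp: bij_betw_def inj_on_def)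
  moreover have "max (- lo a) (- lo b) - min (- hi a) (- hi b) = max (hi a) (hi b) - min (lo a) (lo b)"
    by linarith
  moreover have "swap_paths a \<in> verts (H q p)" "swap_paths b \<in> verts (H q p)"
    using bij_swap_paths[of p q] assms by (auto simp: bij_betw_def)
  ultimately show ?thesis
    using assms by (simp add: hdist_attach_two attach_dist_def neg)
qed

section \<open>Comparison of the spectral radii\<close>

lemma radius_swap: "radius p q = radius q p"
proof -
  \<comment> \<open>One inequality for all \<open>p\<close> and \<open>q\<close> suffices: the
    Perron vector of one hypergraph is a test vector for its mirror image.\<close>
  have "radius p q \<le> radius q p" for p q
  proof -
    let ?V = "verts (H p q)"
    obtain x where x: "\<And>v. v \<in> ?V \<Longrightarrow> x v > 0"
      and eig: "\<And>a. a \<in> ?V \<Longrightarrow> (\<Sum>b\<in>?V. D p q a b * x b) = radius p q * x a"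
      using distance_spectral_radius_perron[OF metric_attach_two] by metis
    have "radius p q * (\<Sum>v\<in>?V. (x v)\<^sup>2) = quad_form (D p q) ?V x"
      using quad_form_eigenvector[OF eig] by simp
    also have "\<dots> = quad_form (\<lambda>a b. D q p (swap_paths a) (swap_paths b)) ?V x"
      by (simp add: quad_form_def D_swap_paths)
    also have "\<dots> \<le> radius q p * (\<Sum>v\<in>?V. (x v)\<^sup>2)"
      by (rule rayleigh_reindexed[OF metric_attach_two bij_swap_paths])
    finally have "radius p q * (\<Sum>v\<in>?V. (x v)\<^sup>2) \<le> radius q p * (\<Sum>v\<in>?V. (x v)\<^sup>2)" .
    moreover have "(\<Sum>v\<in>?V. (x v)\<^sup>2) > 0"
    proof (rule sum_pos2[OF finite_verts])
      show "Base u \<in> ?V" using u by simp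
      then have "x (Base u) > 0" by (rule x)
      then show "(x (Base u))\<^sup>2 > 0" by simp
    qed simp
    ultimately show ?thesis by simp
  qed
  then show ?thesis by (simp add: antisym)
qed

text \<open>Only an inequality: the vertices of the traversed edge that are not joints keep their
  distances to \<open>G\<close>, although their side counts as \<open>-1\<close>.\<close>

lemma D_shift_ge:
  assumes q: "q \<ge> 1" and ab: "a \<in> verts (H p q)" "b \<in> verts (H p q)"
  defines "\<omega> \<equiv> indicator (Base ` (verts G - {u})) :: _ \<Rightarrow> real"
    and "g \<equiv> \<lambda>v. side_sign v + indicator {Base u} v"
  shows "D (p + 1) (q - 1) (shift u a) (shift u b) \<ge> D p q a b + \<omega> a * g b + \<omega> b * g a"
proof -
  let ?S = "Base ` (verts G - {u})"
  let ?len = "\<lambda>z :: 'a pendant_vertex. max (hi z) 0 - min (lo z) 0"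
  \<comment> \<open>On the path, \<open>u\<close> included, \<open>shift\<close> translates
    intervals by \<open>-1\<close>, and \<open>g\<close> bounds from below the change in distance to
    the joint carrying \<open>G\<close>. The vertex \<open>u\<close> itself counts \<open>1\<close>,
    since it leaves that joint.\<close>
  have path: "projection u z = u \<and> projection u (shift u z) = u \<and>
      lo (shift u z) = lo z - 1 \<and> hi (shift u z) = hi z - 1 \<and> \<omega> z = 0 \<and>
      g z \<le> real_of_int (max (hi z - 1) 0 - min (lo z - 1) 0 - ?len z)"
    if "z \<in> verts (H p q)" "z \<notin> ?S" for z
    using that by (cases z) (auto simp: \<omega>_def g_def)
  have base: "shift u z = z \<and> lo z = 0 \<and> hi z = 0 \<and> \<omega> z = 1 \<and> g z = 0"
    if "z \<in> ?S" for z
    using that by (auto simp: \<omega>_def g_def)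
  have D: "D p q a b = real (attach_dist G u a b)"
    "D (p + 1) (q - 1) (shift u a) (shift u b) = real (attach_dist G u (shift u a) (shift u b))"
    using ab bij_betwE[OF bij_shift[OF q, of p]] by (simp_all only: hdist_attach_two)
  have eq: "shift u a = shift u b \<longleftrightarrow> a = b"
    using bij_shift[OF q, of p] ab by (auto simp: bij_betw_def inj_on_def)
  note L = lo_hi[of a] lo_hi[of b] lo_hi[of "shift u a"] lo_hi[of "shift u b"]
  consider "a \<in> ?S" "b \<in> ?S" | "a \<in> ?S" "b \<notin> ?S" | "a \<notin> ?S" "b \<in> ?S" | "a \<notin> ?S" "b \<notin> ?S"
    by blast
  then show ?thesis
  proof cases
    case 1
    then show ?thesis using base[of a] base[of b] D by (simp add: attach_dist_def)
  next
    case 2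
    then have "a \<noteq> b" by blast
    then have "real (attach_dist G u a b) = hdist G (projection u a) u + real_of_int (?len b)"
      "real (attach_dist G u (shift u a) (shift u b)) =
         hdist G (projection u a) u + real_of_int (?len (shift u b))"
      using eq base[OF 2(1)] path[OF ab(2) 2(2)] by (auto simp: attach_dist_def max.commute min.commute)
    then show ?thesis using base[OF 2(1)] path[OF ab(2) 2(2)] D by simp
  next
    case 3
    then have "a \<noteq> b" by blast
    then have "real (attach_dist G u a b) = hdist G u (projection u b) + real_of_int (?len a)"
      "real (attach_dist G u (shift u a) (shift u b)) =
         hdist G u (projection u b) + real_of_int (?len (shift u a))"
      using eq base[OF 3(2)] path[OF ab(1) 3(1)] by (auto simp: attach_dist_def)
    then show ?thesis using base[OF 3(2)] path[OF ab(1) 3(1)] D by simp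
  next
    case 4
    have "max (hi a - 1) (hi b - 1) - min (lo a - 1) (lo b - 1) = max (hi a) (hi b) - min (lo a) (lo b)"
      by linarith
    then show ?thesis
      using path[OF ab(1) 4(1)] path[OF ab(2) 4(2)] D eq by (simp add: attach_dist_def)
  qed
qed

text \<open>By \<open>D_shift_ge\<close> the quadratic form grows by at least
  \<open>2 (\<Sum> \<omega> x) (\<Sum> g x)\<close>. The first factor is positive because of
  \<open>w\<close>, the second because \<open>u\<close> adds a positive term to the nonnegative
  balance \<open>side\<close>.\<close>

lemma radius_less_shift:
  assumes q: "q \<ge> 1" and w: "w \<in> verts G" "w \<noteq> u"
    and x: "\<And>v. v \<in> verts (H p q) \<Longrightarrow> x v > 0"
    and eig: "\<And>a. a \<in> verts (H p q) \<Longrightarrow> (\<Sum>b\<in>verts (H p q). D p q a b * x b) = radius p q * x a"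
    and side: "(\<Sum>v\<in>verts (H p q). side_sign v * x v) \<ge> 0"
  shows "radius p q < radius (p + 1) (q - 1)"
proof -
  let ?V = "verts (H p q)"
  let ?D' = "\<lambda>a b. D (p + 1) (q - 1) (shift u a) (shift u b)"
  define \<omega> where "\<omega> = (indicator (Base ` (verts G - {u})) :: _ \<Rightarrow> real)"
  define g where "g v = side_sign v + indicator {Base u} v" for v :: "'a pendant_vertex"
  have "(\<Sum>v\<in>?V. indicator {Base u} v * x v) = x (Base u)"
    using u by (simp add: indicator_def if_distrib[of "\<lambda>c. c * _"] finite_verts cong: if_cong)
  then have "(\<Sum>v\<in>?V. g v * x v) = (\<Sum>v\<in>?V. side_sign v * x v) + x (Base u)"
    by (simp add: g_def distrib_right sum.distrib)
  then have g_pos: "(\<Sum>v\<in>?V. g v * x v) > 0" using side x[of "Base u"] u by simp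
  have \<omega>_pos: "(\<Sum>v\<in>?V. \<omega> v * x v) > 0"
  proof (rule sum_pos2[OF finite_verts])
    show "Base w \<in> ?V" using w by simp
    then show "0 < \<omega> (Base w) * x (Base w)" using w x by (simp add: \<omega>_def)
    show "0 \<le> \<omega> v * x v" if "v \<in> ?V" for v using x[OF that] by (simp add: \<omega>_def)
  qed
  have "quad_form (D p q) ?V x < quad_form (D p q) ?V x + 2 * ((\<Sum>v\<in>?V. \<omega> v * x v) * (\<Sum>v\<in>?V. g v * x v))"
    using g_pos \<omega>_pos by simp
  also have "\<dots> = (\<Sum>a\<in>?V. \<Sum>b\<in>?V. (D p q a b + \<omega> a * g b + \<omega> b * g a) * x a * x b)"
  proof -
    have "(\<Sum>a\<in>?V. \<Sum>b\<in>?V. \<omega> a * g b * x a * x b) = (\<Sum>v\<in>?V. \<omega> v * x v) * (\<Sum>v\<in>?V. g v * x v)"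
      unfolding sum_product by (simp add: mult_ac)
    moreover have "(\<Sum>a\<in>?V. \<Sum>b\<in>?V. \<omega> b * g a * x a * x b) = (\<Sum>v\<in>?V. g v * x v) * (\<Sum>v\<in>?V. \<omega> v * x v)"
      unfolding sum_product by (simp add: mult_ac)
    ultimately show ?thesis
      by (simp add: quad_form_def distrib_right sum.distrib)
  qed
  also have "\<dots> \<le> quad_form ?D' ?V x"
    unfolding quad_form_def \<omega>_def g_def
    by (intro sum_mono mult_right_mono D_shift_ge q less_imp_le x)
  also have "\<dots> \<le> radius (p + 1) (q - 1) * (\<Sum>v\<in>?V. (x v)\<^sup>2)"
    by (rule rayleigh_reindexed[OF metric_attach_two bij_shift[OF q]])
  finally have "radius p q * (\<Sum>v\<in>?V. (x v)\<^sup>2) < radius (p + 1) (q - 1) * (\<Sum>v\<in>?V. (x v)\<^sup>2)"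
    using quad_form_eigenvector[OF eig] by simp
  then show ?thesis by (rule mult_right_less_imp_less) (simp add: sum_nonneg)
qed

lemma radius_less_shift_either:
  assumes pq: "p \<ge> 1" "q \<ge> 1" and w: "w \<in> verts G" "w \<noteq> u"
  shows "radius p q < radius (p + 1) (q - 1) \<or> radius p q < radius (p - 1) (q + 1)"
proof -
  let ?V = "verts (H p q)" and ?V' = "verts (H q p)"
  obtain x where x: "\<And>v. v \<in> ?V \<Longrightarrow> x v > 0"
    and eig: "\<And>a. a \<in> ?V \<Longrightarrow> (\<Sum>b\<in>?V. D p q a b * x b) = radius p q * x a"
    using distance_spectral_radius_perron[OF metric_attach_two] by metis
  show ?thesis
  proof (cases "(\<Sum>v\<in>?V. side_sign v * x v) \<ge> 0")
    case True
    then show ?thesis using radius_less_shift[OF pq(2) w x eig] by blast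
  next
    case False
    \<comment> \<open>Carried over to \<open>H q p\<close>, the Perron vector has the opposite,
      hence nonnegative, balance between the paths.\<close>
    note bij = bij_swap_paths[of q p]
    have V: "swap_paths v \<in> ?V" if "v \<in> ?V'" for v
      using bij that by (auto simp: bij_betw_def)
    have "radius q p < radius (q + 1) (p - 1)"
    proof (rule radius_less_shift[OF pq(1) w, where x = "\<lambda>v. x (swap_paths v)"])
      show "x (swap_paths v) > 0" if "v \<in> ?V'" for v using x V that by blast
      show "(\<Sum>b\<in>?V'. D q p a b * x (swap_paths b)) = radius q p * x (swap_paths a)"
        if a: "a \<in> ?V'" for a
      proof -
        have "(\<Sum>b\<in>?V'. D q p a b * x (swap_paths b)) =
            (\<Sum>b\<in>?V'. D p q (swap_paths a) (swap_paths b) * x (swap_paths b))"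
          using a by (simp add: D_swap_paths)
        also have "\<dots> = (\<Sum>b\<in>?V. D p q (swap_paths a) b * x b)"
          by (rule sum.reindex_bij_betw[OF bij])
        also have "\<dots> = radius q p * x (swap_paths a)"
          using eig[OF V[OF a]] radius_swap[of p q] by simp
        finally show ?thesis .
      qed
      have "side_sign v = - side_sign (swap_paths v)" if "v \<in> ?V'" for v
        using that by (cases v) auto
      then have "(\<Sum>v\<in>?V'. side_sign v * x (swap_paths v)) =
          (\<Sum>v\<in>?V'. - side_sign (swap_paths v) * x (swap_paths v))" by simp
      also have "\<dots> = (\<Sum>v\<in>?V. - side_sign v * x v)"
        by (rule sum.reindex_bij_betw[OF bij])
      finally show "(\<Sum>v\<in>?V'. side_sign v * x (swap_paths v)) \<ge> 0"
        using False by (simp add: sum_negf)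
    qed
    then show ?thesis using radius_swap by metis
  qed
qed

lemma radius_less:
  assumes "q \<ge> 1" "p \<ge> q" and w: "w \<in> verts G" "w \<noteq> u"
  shows "radius p q < radius (p + 1) (q - 1)"
  using assms(1,2)
proof (induction "p - q" arbitrary: p q rule: less_induct)
  case less
  have "radius p q < radius (p + 1) (q - 1) \<or> radius p q < radius (p - 1) (q + 1)"
    using less.prems by (intro radius_less_shift_either[OF _ _ w]) auto
  moreover have "radius p q < radius (p + 1) (q - 1)" if *: "radius p q < radius (p - 1) (q + 1)"
  proof -
    consider "p = q" | "p = q + 1" | "p \<ge> q + 2" using less.prems by linarith
    then show ?thesis
    proof cases
      \<comment> \<open>The pair \<open>(p - 1, q + 1)\<close> is the target
        \<open>(p + 1, q - 1)\<close> with its paths exchanged.\<close>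
      case 1
      then show ?thesis using * radius_swap[of "q - 1" "q + 1"] by simp
    next
      \<comment> \<open>The pair \<open>(p - 1, q + 1)\<close> is \<open>(p, q)\<close> with its
        paths exchanged, so the assumption is contradictory.\<close>
      case 2
      then show ?thesis using * radius_swap[of q "q + 1"] by simp
    next
      \<comment> \<open>The difference drops by two, and the induction hypothesis bounds
        \<open>radius (p - 1) (q + 1)\<close> by \<open>radius p q\<close>, against the
        assumption.\<close>
      case 3
      then have "radius (p - 1) (q + 1) < radius (p - 1 + 1) (q + 1 - 1)"
        by (intro less.hyps) auto
      then show ?thesis using * 3 by simp
    qed
  qed
  ultimately show ?case by blast
qed

end

theorem theorem3p1:
  fixes G :: "'a hypergraph" and u :: 'a and k p q :: nat
  assumes "k \<ge> 2"
    and "hypergraph G" and "uniform k G" and "connected_hypergraph G"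
    and "card (edges G) \<ge> 1"
    and "u \<in> verts G"
    and "q \<ge> 1" and "p \<ge> q"
  shows "distance_spectral_radius (attach_two k G u p q)
       < distance_spectral_radius (attach_two k G u (p + 1) (q - 1))"
proof -
  interpret pendant_paths G u k
    using assms by unfold_locales
  \<comment> \<open>An edge provides a vertex other than \<open>u\<close>. If \<open>u\<close> were
    the only vertex, both hypergraphs would be loose paths of the same length.\<close>
  obtain e where e: "e \<in> edges G"
    using assms(5) by fastforce
  then have "card e \<ge> 2" "e \<subseteq> verts G"
    using assms by (auto simp: uniform_def hypergraph_def)
  moreover from this have "\<not> e \<subseteq> {u}" using card_mono[of "{u}" e] by auto
  ultimately obtain w where "w \<in> verts G" "w \<noteq> u" by blast
  then show ?thesis using radius_less assms by blast
qed

end
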